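(* Let $X$ be a finite set and $\mathcal{C}\subseteq 2^X$ a set system. Then $\mathcal{C}$ satisfies condition (W') — for all $A,B,C\in\mathcal{C}$, if $A\cap(B\setminus C)\neq\emptyset$ and $A\cap(C\setminus B)\neq\emptyset$ then $B\cap C\subseteq A$ — if and only if $\mathcal{C}$ is a weak hierarchy, i.e., for all $A,B,C\in\mathcal{C}$ we have $A\cap B\cap C\in\{A\cap B,\ A\cap C,\ B\cap C\}$. *)

theory Defs
  imports Main
begin

definition condition_W' :: "'a set set \<Rightarrow> bool" where
  "condition_W' \<C> \<longleftrightarrow>
     (\<forall>A\<in>\<C>. \<forall>B\<in>\<C>. \<forall>C\<in>\<C>.
        A \<inter> (B - C) \<noteq> {} \<and> A \<inter> (C - B) \<noteq> {} \<longrightarrow> B \<inter> C \<subseteq> A)"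

definition weak_hierarchy :: "'a set set \<Rightarrow> bool" where
  "weak_hierarchy \<C> \<longleftrightarrow>
     (\<forall>A\<in>\<C>. \<forall>B\<in>\<C>. \<forall>C\<in>\<C>. A \<inter> B \<inter> C \<in> {A \<inter> B, A \<inter> C, B \<inter> C})"

end

theory Submission
  imports Defs
begin

text \<open>The equivalence holds for each triple separately. The triple intersection lies in every
  pairwise one, and it differs from A \<inter> B iff A meets B - C, and from A \<inter> C iff A
  meets C - B. So (W') is the three-way disjunction with two alternatives negated into
  premises.\<close>

lemma triple_Int_mem_pairwise_Int_iff:
  "A \<inter> B \<inter> C \<in> {A \<inter> B, A \<inter> C, B \<inter> C} \<longleftrightarrow>
   (A \<inter> (B - C) \<noteq> {} \<and> A \<inter> (C - B) \<noteq> {} \<longrightarrow> B \<inter> C \<subseteq> A)"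
proof -
  have "A \<inter> B \<inter> C = A \<inter> B \<longleftrightarrow> A \<inter> (B - C) = {}" by blast
  moreover have "A \<inter> B \<inter> C = A \<inter> C \<longleftrightarrow> A \<inter> (C - B) = {}" by blast
  moreover have "A \<inter> B \<inter> C = B \<inter> C \<longleftrightarrow> B \<inter> C \<subseteq> A" by blast
  ultimately show ?thesis unfolding insert_iff empty_iff by argo
qed

theorem theorem2:
  fixes X :: "'a set" and \<C> :: "'a set set"
  assumes "finite X"
    and "\<C> \<subseteq> Pow X"
  shows "condition_W' \<C> \<longleftrightarrow> weak_hierarchy \<C>"
  \<comment> \<open>Rewriting triple by triple under the quantifiers makes both sides the same
    formula.\<close>
  unfolding condition_W'_def weak_hierarchy_def triple_Int_mem_pairwise_Int_iff ..

end
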